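(* Let $h>0$ and $0\le\alpha<1/4$. Let $g\in\mathcal G$, write $t=\dfrac{2h}{\tan(\pi/4-\alpha)}$, and let $s_p=g+(-t/2,0,h)$, $s_q=g+(t/2,0,h)$ (both in $\mathcal S$). Then $$\varepsilon(g,\{s_p,s_q\})\;\le\;\sqrt{\frac{1+2\alpha}{1-4\alpha}}\;\varepsilon(g,\mathcal S).$$
   Context: Work in $\mathbb{R}^3$ with coordinates $(x,y,z)$. The ground plane is $\mathcal G=\{z=0\}$ and the viewing plane is $\mathcal S=\{z=h\}$, $h>0$. Fix an error bound $\alpha>0$. For a point $s$ and a unit vector $u$, the cone $K(s,u)=\{s+rv:\ r\ge0,\ |v|=1,\ \angle(v,u)\le\alpha\}$ (right circular cone with apex $s$, axis $u$, half-angle $\alpha$). For a target $g$ and camera location $s$, $\mathcal K(g,s)$ is the set of all cones $K(s,u)$, over all unit vectors $u$, containing $g$. For a set $C\subseteq\mathcal S$ of camera locations, the worst-case uncertainty is $\varepsilon(g,C)=\sup\{\operatorname{diam}(\bigcap_{s\in C}K_s): K_s\in\mathcal K(g,s)\ \forall s\in C\}$; $\varepsilon(g,\mathcal S)$ uses every point of $\mathcal S$ as a camera. *)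

theory Defs
  imports "HOL-Analysis.Analysis"
begin

type_synonym pt = "real ^ 3"

definition ground :: "pt set" where
  "ground = {p. p $ 3 = 0}"

definition viewplane :: "real \<Rightarrow> pt set" where
  "viewplane h = {p. p $ 3 = h}"

definition vec_angle :: "pt \<Rightarrow> pt \<Rightarrow> real" where
  "vec_angle v u = arccos ((v \<bullet> u) / (norm v * norm u))"

definition cone3 :: "real \<Rightarrow> pt \<Rightarrow> pt \<Rightarrow> pt set" where
  "cone3 \<alpha> s u = {s + r *\<^sub>R v | r v. r \<ge> 0 \<and> norm v = 1 \<and> vec_angle v u \<le> \<alpha>}"

definition cones_through :: "real \<Rightarrow> pt \<Rightarrow> pt \<Rightarrow> pt set set" where
  "cones_through \<alpha> g s = {cone3 \<alpha> s u | u. norm u = 1 \<and> g \<in> cone3 \<alpha> s u}"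

definition ediam :: "pt set \<Rightarrow> ereal" where
  "ediam S = (if bounded S then ereal (diameter S) else \<infinity>)"

definition unc :: "real \<Rightarrow> pt \<Rightarrow> pt set \<Rightarrow> ereal" where
  "unc \<alpha> g C = Sup {ediam (\<Inter>s\<in>C. K s) | K. \<forall>s\<in>C. K s \<in> cones_through \<alpha> g s}"

end

theory Submission
  imports Defs
begin

text \<open>
  Write \<open>S = sin 2\<alpha>\<close>, \<open>\<gamma> = \<pi>/4 + \<alpha>\<close> and \<open>D = 2hS / (1 - S)\<close>. From every point of the viewing
  plane, \<open>g\<close> and the point at depth \<open>D\<close> below \<open>g\<close> are seen under an angle of at most \<open>2\<alpha>\<close>, so some
  cone contains both and the uncertainty of the whole plane is at least \<open>D\<close>.

  For the two cameras \<open>p\<close>, \<open>q\<close>, let \<open>x\<close>, \<open>y\<close> lie in both cones, with axes \<open>u\<close>, \<open>v\<close>, and let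
  \<open>w = x - y\<close>. The part of \<open>w\<close> orthogonal to \<open>u\<close> has length at most
  \<open>(|x - p| + |y - p|) sin \<alpha>\<close>, and similarly for \<open>v\<close> and \<open>q\<close>. The axes are nearly orthogonal,
  \<open>|u \<bullet> v| \<le> 4\<alpha>\<close>, so the sum of the two squared lengths is at least \<open>(1 - 4\<alpha>)|w|\<^sup>2\<close>. All four
  distances are at most \<open>L = h sin \<gamma> / cos\<^sup>2 \<gamma>\<close>. This alone is not quite enough, but if \<open>|w| > D\<close>
  then \<open>|x - p|\<close> and \<open>|y - p|\<close> must differ so much that their sum is at most \<open>2L cos \<alpha>\<close>, which
  bounds the squared lengths by \<open>(1 + S)D\<^sup>2 / 2\<close> each.
\<close>

section \<open>Cones and angles expressed through inner products\<close>

text \<open>\<open>cos\<close> is decreasing on [0, pi], so the angle bound turns into a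
  division-free inequality. In this form the apex needs no special treatment later.\<close>

lemma cone3_iff:
  assumes "norm u = 1" "0 \<le> \<alpha>" "\<alpha> \<le> pi"
  shows "x \<in> cone3 \<alpha> s u \<longleftrightarrow> cos \<alpha> * norm (x - s) \<le> (x - s) \<bullet> u"
proof -
  have angle: "vec_angle v u \<le> \<alpha> \<longleftrightarrow> cos \<alpha> \<le> v \<bullet> u" if "norm v = 1" for v
  proof -
    have b: "\<bar>v \<bullet> u\<bar> \<le> 1"
      using Cauchy_Schwarz_ineq2[of v u] that assms(1) by simp
    have "arccos (v \<bullet> u) \<le> \<alpha> \<longleftrightarrow> cos \<alpha> \<le> cos (arccos (v \<bullet> u))"
      using b assms by (intro cos_mono_le_eq[symmetric]) (auto intro: arccos_lbound arccos_ubound)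
    then show ?thesis
      using b that assms(1) by (simp add: vec_angle_def cos_arccos_abs)
  qed
  show ?thesis
  proof
    assume "x \<in> cone3 \<alpha> s u"
    then obtain r v where "x = s + r *\<^sub>R v" "r \<ge> 0" "norm v = 1" "vec_angle v u \<le> \<alpha>"
      unfolding cone3_def by auto
    then show "cos \<alpha> * norm (x - s) \<le> (x - s) \<bullet> u"
      using angle[of v] by (simp add: mult.commute mult_left_mono)
  next
    assume c: "cos \<alpha> * norm (x - s) \<le> (x - s) \<bullet> u"
    show "x \<in> cone3 \<alpha> s u"
    proof (cases "x = s")
      case True
      \<comment> \<open>The apex is the case \<open>r = 0\<close>, which still requires some
        admissible direction; the axis itself serves.\<close>
      have "vec_angle u u \<le> \<alpha>"
        using angle[of u] assms(1) by (simp add: norm_eq_1)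
      then show ?thesis
        unfolding cone3_def using True assms(1)
        by (intro CollectI exI[of _ "0::real"] exI[of _ u]) simp
    next
      case False
      have "cos \<alpha> \<le> sgn (x - s) \<bullet> u"
        using c False by (simp add: sgn_div_norm pos_le_divide_eq divide_inverse_commute[symmetric])
      then have "vec_angle (sgn (x - s)) u \<le> \<alpha>"
        using angle[of "sgn (x - s)"] False by (simp add: norm_sgn)
      then show ?thesis
        unfolding cone3_def using False
        by (intro CollectI exI[of _ "norm (x - s)"] exI[of _ "sgn (x - s)"])
          (simp add: norm_sgn, simp add: sgn_div_norm)
    qed
  qed
qed

text \<open>Triangle inequality for angles, in cosine form. The components of \<open>a\<close> and
  \<open>c\<close> orthogonal to \<open>b\<close> have lengths \<open>sin A\<close> and
  \<open>sin B\<close>, and Cauchy-Schwarz for them yields the addition formula for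
  \<open>cos (A + B)\<close>.\<close>

lemma spherical_triangle_ineq:
  fixes a b c :: "'a::real_inner"
  assumes n: "norm a = 1" "norm b = 1" "norm c = 1"
    and ab: "cos \<theta> \<le> a \<bullet> b" and bc: "cos \<phi> \<le> b \<bullet> c"
    and r: "0 \<le> \<theta>" "0 \<le> \<phi>" "\<theta> + \<phi> \<le> pi"
  shows "cos (\<theta> + \<phi>) \<le> a \<bullet> c"
proof -
  define A B where "A = arccos (a \<bullet> b)" and "B = arccos (b \<bullet> c)"
  have bd: "\<bar>a \<bullet> b\<bar> \<le> 1" "\<bar>b \<bullet> c\<bar> \<le> 1"
    using Cauchy_Schwarz_ineq2[of a b] Cauchy_Schwarz_ineq2[of b c] n by simp_all
  have cA: "cos A = a \<bullet> b" and cB: "cos B = b \<bullet> c"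
    using bd by (simp_all add: A_def B_def cos_arccos_abs)
  have A: "0 \<le> A" "A \<le> pi" and B: "0 \<le> B" "B \<le> pi"
    using bd by (simp_all add: A_def B_def arccos_lbound arccos_ubound abs_le_iff)
  have "A \<le> \<theta>"
    using cos_mono_le_eq[of \<theta> A] A r ab cA by simp
  moreover have "B \<le> \<phi>"
    using cos_mono_le_eq[of \<phi> B] B r bc cB by simp
  ultimately have "cos (\<theta> + \<phi>) \<le> cos (A + B)"
    using A B r by (intro cos_monotone_0_pi_le) auto
  also have "\<dots> \<le> a \<bullet> c"
  proof -
    define a' c' where "a' = a - (a \<bullet> b) *\<^sub>R b" and "c' = c - (b \<bullet> c) *\<^sub>R b"
    have u: "a \<bullet> a = 1" "b \<bullet> b = 1" "c \<bullet> c = 1"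
      using n by (simp_all add: norm_eq_1)
    have "(norm a')\<^sup>2 = 1 - (a \<bullet> b)\<^sup>2" "(norm c')\<^sup>2 = 1 - (b \<bullet> c)\<^sup>2"
      unfolding power2_norm_eq_inner
      by (simp_all add: a'_def c'_def inner_diff_left inner_diff_right
          u inner_commute power2_eq_square)
    then have "norm a' = sin A" "norm c' = sin B"
      using A B by (simp_all add: cA[symmetric] cB[symmetric] sin_squared_eq[symmetric]
          sin_ge_zero)
    moreover have "a' \<bullet> c' = a \<bullet> c - cos A * cos B"
      by (simp add: a'_def c'_def cA cB inner_diff_left inner_diff_right u inner_commute)
    ultimately show ?thesis
      using Cauchy_Schwarz_ineq2[of a' c'] by (simp add: cos_add)
  qed
  finally show ?thesis .
qed

text \<open>Homogeneous form of the angle triangle inequality, with zero vectors included, so that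
  it applies directly to differences of points.\<close>

lemma inner_ge_of_axis:
  fixes X Y u :: "'a::real_inner"
  assumes u: "norm u = 1" and r: "0 \<le> \<theta>" "0 \<le> \<phi>" "\<theta> + \<phi> \<le> pi"
    and X: "cos \<theta> * norm X \<le> X \<bullet> u" and Y: "cos \<phi> * norm Y \<le> Y \<bullet> u"
  shows "cos (\<theta> + \<phi>) * (norm X * norm Y) \<le> X \<bullet> Y"
proof (cases "X = 0 \<or> Y = 0")
  case False
  have "cos \<theta> \<le> sgn X \<bullet> u" "cos \<phi> \<le> u \<bullet> sgn Y"
    using X Y False by (simp_all add: sgn_div_norm field_simps inner_commute)
  then have "cos (\<theta> + \<phi>) \<le> sgn X \<bullet> sgn Y"
    using u r False by (intro spherical_triangle_ineq[of _ u]) (auto simp: norm_sgn)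
  then show ?thesis
    using False by (simp add: sgn_div_norm field_simps)
qed auto

text \<open>The normalized bisector of the two directions halves their angle. The bound
  \<open>2 * \<alpha> < pi\<close> makes \<open>cos \<alpha>\<close> positive and hence keeps
  \<open>v + w\<close> away from 0.\<close>

lemma common_axis_exists:
  fixes X Y :: "'a::real_inner"
  assumes "X \<noteq> 0" "Y \<noteq> 0" "0 \<le> \<alpha>" "2 * \<alpha> < pi"
    and XY: "cos (2 * \<alpha>) * (norm X * norm Y) \<le> X \<bullet> Y"
  obtains u where "norm u = 1" "cos \<alpha> * norm X \<le> X \<bullet> u" "cos \<alpha> * norm Y \<le> Y \<bullet> u"
proof -
  define v w m where "v = sgn X" and "w = sgn Y" and "m = v + w"
  have n: "v \<bullet> v = 1" "w \<bullet> w = 1"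
    using assms by (simp_all add: v_def w_def norm_sgn flip: norm_eq_1)
  have "cos (2 * \<alpha>) \<le> v \<bullet> w"
    using XY assms by (simp add: v_def w_def sgn_div_norm field_simps)
  then have c: "2 * (cos \<alpha>)\<^sup>2 \<le> 1 + v \<bullet> w"
    by (simp add: cos_double_cos)
  have pos: "cos \<alpha> > 0"
    using assms by (intro cos_gt_zero_pi) auto
  have m2: "(norm m)\<^sup>2 = 2 * (1 + v \<bullet> w)"
    by (simp add: m_def power2_norm_eq_inner inner_add_left inner_add_right n inner_commute)
  have "(2 * cos \<alpha>)\<^sup>2 \<le> (norm m)\<^sup>2"
    using c by (simp add: m2 power_mult_distrib)
  then have m: "2 * cos \<alpha> \<le> norm m"
    by (rule power2_le_imp_le) simp
  then have m0: "norm m > 0"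
    using pos by linarith
  have "v \<bullet> m = (norm m)\<^sup>2 / 2" "w \<bullet> m = (norm m)\<^sup>2 / 2"
    unfolding m2 by (simp_all add: m_def inner_add_right n inner_commute)
  then have "v \<bullet> sgn m = norm m / 2" "w \<bullet> sgn m = norm m / 2"
    using m0 by (simp_all add: sgn_div_norm power2_eq_square field_simps)
  then have "cos \<alpha> \<le> v \<bullet> sgn m" "cos \<alpha> \<le> w \<bullet> sgn m"
    using m by simp_all
  then have "cos \<alpha> * norm X \<le> X \<bullet> sgn m" "cos \<alpha> * norm Y \<le> Y \<bullet> sgn m"
    using assms by (simp_all add: v_def w_def sgn_div_norm[of X] sgn_div_norm[of Y] field_simps)
  then show ?thesis
    using m0 by (intro that[of "sgn m"]) (auto simp: norm_sgn)
qed

section \<open>Components along and across two axes\<close>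

text \<open>By Pythagoras the left side is the squared length of the part of \<open>X - Y\<close>
  orthogonal to \<open>u\<close>. Rejection from \<open>u\<close> is linear, and it shortens a
  vector of the cone to at most \<open>sin \<alpha>\<close> times its length.\<close>

lemma norm_reject_le:
  fixes X Y u :: "'a::real_inner"
  assumes "norm u = 1" "0 \<le> \<alpha>" "2 * \<alpha> \<le> pi"
    and X: "cos \<alpha> * norm X \<le> X \<bullet> u" and Y: "cos \<alpha> * norm Y \<le> Y \<bullet> u"
  shows "(norm (X - Y))\<^sup>2 - ((X - Y) \<bullet> u)\<^sup>2 \<le> ((norm X + norm Y) * sin \<alpha>)\<^sup>2"
proof -
  define P where "P Z = Z - (Z \<bullet> u) *\<^sub>R u" for Z
  have uu: "u \<bullet> u = 1"
    using assms(1) by (simp add: norm_eq_1)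
  have P2: "(norm (P Z))\<^sup>2 = (norm Z)\<^sup>2 - (Z \<bullet> u)\<^sup>2" for Z
    unfolding power2_norm_eq_inner
    by (simp add: P_def inner_diff_left inner_diff_right uu inner_commute
        power2_eq_square)
  have c0: "cos \<alpha> \<ge> 0" and s0: "sin \<alpha> \<ge> 0"
    using assms by (auto intro!: cos_ge_zero sin_ge_zero)
  have P: "norm (P Z) \<le> norm Z * sin \<alpha>" if "cos \<alpha> * norm Z \<le> Z \<bullet> u" for Z
  proof (rule power2_le_imp_le)
    have "(cos \<alpha> * norm Z)\<^sup>2 \<le> (Z \<bullet> u)\<^sup>2"
      using that c0 by (intro power_mono) auto
    then show "(norm (P Z))\<^sup>2 \<le> (norm Z * sin \<alpha>)\<^sup>2"
      by (simp add: P2 power_mult_distrib sin_squared_eq algebra_simps)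
  qed (use s0 in simp)
  have "P (X - Y) = P X - P Y"
    by (simp add: P_def inner_diff_left algebra_simps)
  then have "norm (P (X - Y)) \<le> norm (P X) + norm (P Y)"
    by (simp add: norm_triangle_ineq4)
  also have "\<dots> \<le> (norm X + norm Y) * sin \<alpha>"
    using P[OF X] P[OF Y] by (simp add: algebra_simps)
  finally show ?thesis
    by (subst P2[symmetric]) (intro power_mono, auto)
qed

text \<open>The factor \<open>1 + \<bar>u \<bullet> v\<bar>\<close> is the largest eigenvalue of the
  Gram matrix of \<open>u\<close> and \<open>v\<close>.\<close>

lemma sum_inner_squares_le:
  fixes u v w :: "'a::real_inner"
  assumes "norm u = 1" "norm v = 1"
  shows "(w \<bullet> u)\<^sup>2 + (w \<bullet> v)\<^sup>2 \<le> (1 + \<bar>u \<bullet> v\<bar>) * (norm w)\<^sup>2"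
proof -
  define A B c where "A = w \<bullet> u" and "B = w \<bullet> v" and "c = u \<bullet> v"
  define Q where "Q = A\<^sup>2 + B\<^sup>2"
  have uv: "u \<bullet> u = 1" "v \<bullet> v = 1"
    using assms by (simp_all add: norm_eq_1)
  have "2 * \<bar>A * B\<bar> \<le> Q"
    unfolding Q_def using sum_squares_bound[of "\<bar>A\<bar>" "\<bar>B\<bar>"] by (simp add: abs_mult)
  then have "\<bar>c\<bar> * (2 * \<bar>A * B\<bar>) \<le> \<bar>c\<bar> * Q"
    by (intro mult_left_mono) auto
  moreover have "2 * A * B * c \<le> \<bar>c\<bar> * (2 * \<bar>A * B\<bar>)"
    using abs_ge_self[of "2 * A * B * c"] by (simp add: abs_mult mult_ac)
  moreover have "(norm (A *\<^sub>R u + B *\<^sub>R v))\<^sup>2 = Q + 2 * A * B * c"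
    unfolding power2_norm_eq_inner
    by (simp add: inner_add_left inner_add_right uv inner_commute Q_def
        c_def power2_eq_square)
  ultimately have n: "(norm (A *\<^sub>R u + B *\<^sub>R v))\<^sup>2 \<le> (1 + \<bar>c\<bar>) * Q"
    by (simp add: algebra_simps)
  \<comment> \<open>Cauchy-Schwarz for this product gives a bound on \<open>Q\<^sup>2\<close> that
    is itself linear in \<open>Q\<close>, so one factor \<open>Q\<close> cancels.\<close>
  have "Q = w \<bullet> (A *\<^sub>R u + B *\<^sub>R v)"
    by (simp add: Q_def A_def B_def inner_add_right power2_eq_square)
  then have "Q\<^sup>2 \<le> (norm w)\<^sup>2 * (norm (A *\<^sub>R u + B *\<^sub>R v))\<^sup>2"
    using Cauchy_Schwarz_ineq[of w "A *\<^sub>R u + B *\<^sub>R v"] by (simp add: power2_norm_eq_inner)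
  also have "\<dots> \<le> (norm w)\<^sup>2 * ((1 + \<bar>c\<bar>) * Q)"
    using n by (intro mult_left_mono) auto
  finally have "Q * Q \<le> ((1 + \<bar>c\<bar>) * (norm w)\<^sup>2) * Q"
    by (simp add: power2_eq_square mult_ac)
  then have "Q \<le> (1 + \<bar>c\<bar>) * (norm w)\<^sup>2" if "Q > 0"
    using that by simp
  moreover have "0 \<le> (1 + \<bar>c\<bar>) * (norm w)\<^sup>2"
    by simp
  ultimately have "Q \<le> (1 + \<bar>c\<bar>) * (norm w)\<^sup>2"
    by linarith
  then show ?thesis
    by (simp add: Q_def A_def B_def c_def)
qed

text \<open>A chord \<open>2 * sin (\<alpha> / 2)\<close> is no longer than its arc.\<close>

lemma norm_unit_diff_le:
  fixes u d :: "'a::real_inner"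
  assumes "norm u = 1" "norm d = 1" "0 \<le> \<alpha>" "cos \<alpha> \<le> d \<bullet> u"
  shows "norm (u - d) \<le> \<alpha>"
proof (rule power2_le_imp_le)
  have "(norm (u - d))\<^sup>2 = 2 - 2 * (d \<bullet> u)"
    using assms(1,2) by (simp add: power2_norm_eq_inner inner_diff_left inner_diff_right
        norm_eq_1 inner_commute)
  also have "\<dots> \<le> 2 - 2 * cos (2 * (\<alpha> / 2))"
    using assms by simp
  also have "\<dots> = 4 * (sin (\<alpha> / 2))\<^sup>2"
    unfolding cos_double_sin by simp
  also have "\<dots> \<le> 4 * (\<alpha> / 2)\<^sup>2"
    using abs_sin_x_le_abs_x[of "\<alpha> / 2"] abs_le_square_iff[of "sin (\<alpha> / 2)" "\<alpha> / 2"] by simp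
  finally show "(norm (u - d))\<^sup>2 \<le> \<alpha>\<^sup>2"
    by (simp add: power2_eq_square)
qed (use assms in simp)

text \<open>Replacing one unit vector of an inner product by another at distance at most \<alpha>
  changes the product by at most \<alpha>; this is done once for each factor.\<close>

lemma abs_inner_axes_le:
  fixes u v d e :: "'a::real_inner"
  assumes "norm u = 1" "norm d = 1" "cos \<alpha> \<le> d \<bullet> u"
    and "norm v = 1" "norm e = 1" "cos \<alpha> \<le> e \<bullet> v" and "0 \<le> \<alpha>"
  shows "\<bar>u \<bullet> v\<bar> \<le> \<bar>d \<bullet> e\<bar> + 2 * \<alpha>"
proof -
  have "u \<bullet> v = d \<bullet> e + (u - d) \<bullet> v + d \<bullet> (v - e)"
    by (simp add: inner_diff_left inner_diff_right)
  moreover have "\<bar>(u - d) \<bullet> v\<bar> \<le> \<alpha>"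
    using Cauchy_Schwarz_ineq2[of "u - d" v] norm_unit_diff_le[of u d \<alpha>] assms by simp
  moreover have "\<bar>d \<bullet> (v - e)\<bar> \<le> \<alpha>"
    using Cauchy_Schwarz_ineq2[of d "v - e"] norm_unit_diff_le[of v e \<alpha>] assms by simp
  ultimately show ?thesis
    by linarith
qed

section \<open>Distances from the cameras to points of the intersection\<close>

text \<open>Law of sines in the triangle 0, t e, X, where 0 and t e are the two cameras, X is seen
  from 0 within 2 \<alpha> of \<open>d\<close>, and the angle at t e is at most
  \<open>\<gamma>\<close>. The angle \<open>\<beta>\<close> at 0 is so confined that
  \<open>\<gamma> + \<beta>\<close> stays within 2 \<alpha> of a right angle.\<close>

lemma triangle_side_le:
  fixes X e d :: "'a::real_inner"
  assumes \<alpha>: "0 \<le> \<alpha>" "\<alpha> < pi/4" and t: "0 \<le> t"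
    and n: "norm e = 1" "norm d = 1"
    and de: "d \<bullet> e = cos (pi/4 - \<alpha>)"
    and Xd: "cos (2 * \<alpha>) * norm X \<le> X \<bullet> d"
    and far: "cos (pi/4 + \<alpha>) * norm (X - t *\<^sub>R e) \<le> t - X \<bullet> e"
  shows "norm X \<le> t / (2 * cos (pi/4 + \<alpha>))"
proof (cases "X = 0")
  case True
  have "cos (pi/4 + \<alpha>) > 0"
    using \<alpha> by (intro cos_gt_zero_pi) auto
  then show ?thesis
    using True t by simp
next
  case False
  define \<gamma> where "\<gamma> = pi/4 + \<alpha>"
  define v where "v = sgn X"
  define \<beta> where "\<beta> = arccos (v \<bullet> e)"
  have nv: "norm v = 1"
    using False by (simp add: v_def norm_sgn)
  have X: "X = norm X *\<^sub>R v"
    using False by (simp add: v_def sgn_div_norm)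
  have bd: "\<bar>v \<bullet> e\<bar> \<le> 1"
    using Cauchy_Schwarz_ineq2[of v e] nv n by simp
  have \<beta>: "0 \<le> \<beta>" "\<beta> \<le> pi" "cos \<beta> = v \<bullet> e"
    using bd by (simp_all add: \<beta>_def arccos_lbound arccos_ubound abs_le_iff cos_arccos_abs)
  have vd: "cos (2 * \<alpha>) \<le> v \<bullet> d"
    using Xd False by (simp add: v_def sgn_div_norm field_simps)
  have "cos (2 * \<alpha> + (pi/4 - \<alpha>)) \<le> v \<bullet> e"
    using \<alpha> by (intro spherical_triangle_ineq[OF nv n(2,1) vd]) (auto simp: de)
  then have "cos \<gamma> \<le> cos \<beta>"
    by (simp add: \<beta> \<gamma>_def algebra_simps)
  then have \<beta>1: "\<beta> \<le> \<gamma>"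
    using cos_mono_le_eq[of \<gamma> \<beta>] \<beta> \<alpha> by (simp add: \<gamma>_def)
  \<comment> \<open>Reverse triangle inequality: \<open>X\<close> is within 2 \<alpha> of
    \<open>d\<close>, and \<open>d\<close> is at angle \<open>pi/4 - \<alpha>\<close> from
    \<open>e\<close>.\<close>
  have \<beta>2: "pi/4 - 3 * \<alpha> \<le> \<beta>"
  proof (rule ccontr)
    assume c: "\<not> ?thesis"
    have "cos (2 * \<alpha> + \<beta>) \<le> d \<bullet> e"
      using \<alpha> c \<beta> vd by (intro spherical_triangle_ineq[OF n(2) nv n(1)])
        (auto simp: inner_commute)
    then have "pi/4 - \<alpha> \<le> 2 * \<alpha> + \<beta>"
      unfolding de using cos_mono_le_eq[of "2 * \<alpha> + \<beta>" "pi/4 - \<alpha>"] \<alpha> c \<beta> by simp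
    then show False
      using c by simp
  qed
  have cg: "cos \<gamma> > 0" and sg: "sin \<gamma> > 0"
    using \<alpha> by (auto simp: \<gamma>_def intro!: cos_gt_zero_pi sin_gt_zero)
  \<comment> \<open>Legs of the right triangle obtained by dropping the perpendicular from
    \<open>X\<close> to the baseline: \<open>y\<close> is the height, \<open>x\<close> the signed
    distance from its foot to the far camera. The bound on the far angle becomes y/x at most
    \<open>tan \<gamma>\<close>.\<close>
  define x y where "x = t - norm X * cos \<beta>" and "y = norm X * sin \<beta>"
  have y0: "y \<ge> 0"
    using \<beta> by (simp add: y_def sin_ge_zero)
  have Xe: "X \<bullet> e = norm X * cos \<beta>"
    by (subst X) (simp add: \<beta>)
  have "(norm (X - t *\<^sub>R e))\<^sup>2 = (norm X)\<^sup>2 + t\<^sup>2 - 2 * t * (X \<bullet> e)"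
    using n(1) unfolding power2_norm_eq_inner
    by (simp add: inner_diff_left inner_diff_right norm_eq_1
        inner_commute power2_eq_square)
  also have "\<dots> = x\<^sup>2 + y\<^sup>2"
    unfolding Xe x_def y_def power_mult_distrib sin_squared_eq
    by (simp add: power2_eq_square algebra_simps)
  finally have nn: "(norm (X - t *\<^sub>R e))\<^sup>2 = x\<^sup>2 + y\<^sup>2" .
  have fx: "cos \<gamma> * norm (X - t *\<^sub>R e) \<le> x"
    using far by (simp add: x_def Xe \<gamma>_def)
  then have x0: "x \<ge> 0"
    using cg by (meson less_imp_le mult_nonneg_nonneg norm_ge_zero order_trans)
  have "(cos \<gamma> * norm (X - t *\<^sub>R e))\<^sup>2 \<le> x\<^sup>2"
    using fx cg by (intro power_mono) auto
  then have "(cos \<gamma> * y)\<^sup>2 \<le> (sin \<gamma> * x)\<^sup>2"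
    by (simp add: power_mult_distrib nn sin_squared_eq algebra_simps)
  then have "cos \<gamma> * y \<le> sin \<gamma> * x"
    using sg x0 by (auto dest: power2_le_imp_le)
  then have "norm X * sin (\<gamma> + \<beta>) \<le> t * sin \<gamma>"
    by (simp add: x_def y_def sin_add algebra_simps)
  moreover have "sin (\<gamma> + \<beta>) \<ge> 2 * sin \<gamma> * cos \<gamma>"
  proof -
    \<comment> \<open>\<open>\<delta>\<close> is the deviation of \<open>\<gamma> + \<beta>\<close>
      from a right angle.\<close>
    define \<delta> where "\<delta> = \<beta> + \<alpha> - pi/4"
    have "\<bar>\<delta>\<bar> \<le> 2 * \<alpha>"
      using \<beta>1 \<beta>2 by (auto simp: \<delta>_def \<gamma>_def abs_le_iff)
    then have "cos (2 * \<alpha>) \<le> cos \<bar>\<delta>\<bar>"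
      using \<alpha> by (intro cos_monotone_0_pi_le) auto
    moreover have "cos \<bar>\<delta>\<bar> = sin (\<gamma> + \<beta>)"
    proof -
      have "\<gamma> + \<beta> = \<delta> + pi/2"
        by (simp add: \<gamma>_def \<delta>_def)
      then show ?thesis
        by (simp add: sin_add)
    qed
    moreover have "cos (2 * \<alpha>) = sin (2 * \<gamma>)"
      by (simp add: \<gamma>_def sin_add distrib_left)
    ultimately show ?thesis
      by (simp add: sin_double)
  qed
  ultimately have "norm X * (2 * sin \<gamma> * cos \<gamma>) \<le> t * sin \<gamma>"
    by (meson mult_left_mono norm_ge_zero order_trans)
  then have "(norm X * (2 * cos \<gamma>)) * sin \<gamma> \<le> t * sin \<gamma>"
    by (simp add: mult_ac)
  then have "norm X * (2 * cos \<gamma>) \<le> t"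
    using sg by simp
  then show ?thesis
    using cg by (simp add: \<gamma>_def field_simps)
qed

text \<open>The hypothesis \<open>far\<close> is what the law of cosines gives for points at least
  \<open>D\<close> apart seen under at most 2 \<alpha>. It forces \<open>\<bar>a - b\<bar>\<close>
  to be at least \<open>2 * L * (1 - cos \<alpha>)\<close>; since the larger side is at most
  \<open>L\<close>, the sum drops by this amount below \<open>2 * L\<close>.\<close>

lemma sum_sides_le:
  fixes a b L D \<alpha> :: real
  assumes \<alpha>: "0 \<le> \<alpha>" "\<alpha> \<le> 1/4" and "0 \<le> L"
    and ab: "0 \<le> a" "a \<le> L" "0 \<le> b" "b \<le> L"
    and D: "(1 + sin (2 * \<alpha>)) * D\<^sup>2 = 2 * L\<^sup>2 * (sin (2 * \<alpha>))\<^sup>2"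
    and far: "D\<^sup>2 \<le> (a - b)\<^sup>2 + 4 * (a * b) * (sin \<alpha>)\<^sup>2"
  shows "a + b \<le> 2 * L * cos \<alpha>"
proof -
  define S C where "S = sin (2 * \<alpha>)" and "C = cos (2 * \<alpha>)"
  have sa: "2 * (sin \<alpha>)\<^sup>2 = 1 - C"
    by (simp add: C_def cos_double_sin)
  have "\<bar>sin \<alpha>\<bar> \<le> \<bar>1/4\<bar>"
    using abs_sin_x_le_abs_x[of \<alpha>] \<alpha> by simp
  then have "(sin \<alpha>)\<^sup>2 \<le> (1/4)\<^sup>2"
    by (simp only: abs_le_square_iff)
  then have C: "7/8 \<le> C"
    using sa by (simp add: power2_eq_square)
  have C1: "C \<le> 1"
    by (simp add: C_def)
  have S: "0 \<le> S" "S \<le> 1/2"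
    using abs_sin_x_le_abs_x[of "2 * \<alpha>"] \<alpha> pi_gt3 by (auto simp: S_def intro!: sin_ge_zero)
  have SC: "S\<^sup>2 = (1 - C) * (1 + C)"
    by (simp add: S_def C_def sin_squared_eq power2_eq_square algebra_simps)
  have "a * b \<le> L\<^sup>2"
    using ab by (simp add: power2_eq_square mult_mono)
  then have "4 * (a * b) * (sin \<alpha>)\<^sup>2 \<le> 4 * L\<^sup>2 * (sin \<alpha>)\<^sup>2"
    by (intro mult_right_mono) auto
  also have "\<dots> = 2 * L\<^sup>2 * (1 - C)"
    by (simp flip: sa)
  finally have k: "D\<^sup>2 - 2 * L\<^sup>2 * (1 - C) \<le> (a - b)\<^sup>2"
    using far by linarith
  \<comment> \<open>The target is (a - b)^2 at least (L (1 - C))^2. After inserting the value of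
    \<open>D\<^sup>2\<close> and cancelling L^2 (1 - C), there remains (1 - C)(1 + S) at most 2 (C -
    S), and \<alpha> \<le> 1/4 gives 3/16 against 3/4.\<close>
  have "(1 - C) * (1 + S) \<le> (1/8) * (3/2)"
    using C C1 S by (intro mult_mono) auto
  then have "(1 - C) * (1 + S) \<le> 2 * (C - S)"
    using C S by simp
  then have "(L\<^sup>2 * (1 - C)) * ((1 - C) * (1 + S)) \<le> (L\<^sup>2 * (1 - C)) * (2 * (C - S))"
    using C1 by (intro mult_left_mono) auto
  also have "\<dots> = 2 * L\<^sup>2 * S\<^sup>2 - (1 + S) * (2 * L\<^sup>2 * (1 - C))"
    unfolding SC by (simp add: algebra_simps)
  also have "\<dots> = (1 + S) * (D\<^sup>2 - 2 * L\<^sup>2 * (1 - C))"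
    using D by (simp add: S_def algebra_simps)
  also have "\<dots> \<le> (1 + S) * (a - b)\<^sup>2"
    using k S by (intro mult_left_mono) auto
  finally have "(1 + S) * (L * (1 - C))\<^sup>2 \<le> (1 + S) * (a - b)\<^sup>2"
    by (simp add: power2_eq_square mult_ac)
  then have "(L * (1 - C))\<^sup>2 \<le> (a - b)\<^sup>2"
    using S by simp
  then have k: "L * (1 - C) \<le> \<bar>a - b\<bar>"
    using C1 \<open>0 \<le> L\<close> by (simp flip: abs_le_square_iff)
  have "0 \<le> cos \<alpha>"
    using \<alpha> pi_gt3 by (intro cos_ge_zero) auto
  moreover have "1 - C = 2 * (1 - cos \<alpha>) * (1 + cos \<alpha>)"
    unfolding C_def cos_double_cos by (simp add: power2_eq_square algebra_simps)
  ultimately have "2 * (1 - cos \<alpha>) \<le> 1 - C"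
    using cos_le_one[of \<alpha>] by (simp add: mult_le_cancel_left1 not_less)
  then have "L * (2 * (1 - cos \<alpha>)) \<le> L * (1 - C)"
    using \<open>0 \<le> L\<close> by (rule mult_left_mono)
  then have "L * (2 * (1 - cos \<alpha>)) \<le> \<bar>a - b\<bar>"
    using k by simp
  moreover have "a + b \<le> 2 * L - \<bar>a - b\<bar>"
    using ab by linarith
  ultimately show ?thesis
    by (simp add: algebra_simps)
qed

section \<open>The upper bound for two cameras\<close>

text \<open>Here \<open>e\<close> is the direction of the baseline from \<open>p\<close> to
  \<open>q\<close>, and \<open>d\<close>, \<open>d'\<close> play the directions from the cameras to
  the target; both axes lie within \<alpha> of them.\<close>

lemma two_cone_dist_le:
  fixes p q x y u v e d d' :: "'a::real_inner"
  assumes \<alpha>: "0 \<le> \<alpha>" "\<alpha> < 1/4" and t: "0 \<le> t" and "0 \<le> D"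
    and L: "L = t / (2 * cos (pi/4 + \<alpha>))"
    and D: "(1 + sin (2 * \<alpha>)) * D\<^sup>2 = 2 * L\<^sup>2 * (sin (2 * \<alpha>))\<^sup>2"
    and unit: "norm u = 1" "norm v = 1" "norm e = 1" "norm d = 1" "norm d' = 1"
    and base: "q = p + t *\<^sub>R e"
    and de: "d \<bullet> e = cos (pi/4 - \<alpha>)" and d'e: "d' \<bullet> (- e) = cos (pi/4 - \<alpha>)"
    and dd': "d \<bullet> d' = - sin (2 * \<alpha>)"
    and du: "cos \<alpha> \<le> d \<bullet> u" and d'v: "cos \<alpha> \<le> d' \<bullet> v"
    and xp: "cos \<alpha> * norm (x - p) \<le> (x - p) \<bullet> u"
    and xq: "cos \<alpha> * norm (x - q) \<le> (x - q) \<bullet> v"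
    and yp: "cos \<alpha> * norm (y - p) \<le> (y - p) \<bullet> u"
    and yq: "cos \<alpha> * norm (y - q) \<le> (y - q) \<bullet> v"
  shows "(1 - 4 * \<alpha>) * (norm (x - y))\<^sup>2 \<le> (1 + 2 * \<alpha>) * D\<^sup>2"
proof (cases "norm (x - y) \<le> D")
  case True
  then have "(norm (x - y))\<^sup>2 \<le> D\<^sup>2"
    by (intro power_mono) auto
  then show ?thesis
    using \<alpha> by (intro mult_mono) auto
next
  case False
  have pi: "\<alpha> < pi/4" "4 * \<alpha> \<le> pi"
    using \<alpha> pi_gt3 by simp_all
  \<comment> \<open>Passing from \<open>z\<close> over the axis to \<open>d\<close> costs 2
    \<alpha>, and on to \<open>e\<close> another \<open>pi/4 - \<alpha>\<close>. So each base angle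
    is at most \<open>pi/4 + \<alpha>\<close>, and the side bound applies to the triangle and to its
    mirror image.\<close>
  have side: "norm (z - p) \<le> L \<and> norm (z - q) \<le> L"
    if zp: "cos \<alpha> * norm (z - p) \<le> (z - p) \<bullet> u"
      and zq: "cos \<alpha> * norm (z - q) \<le> (z - q) \<bullet> v" for z
  proof -
    have 1: "cos (2 * \<alpha>) * norm (z - p) \<le> (z - p) \<bullet> d"
      using inner_ge_of_axis[of u \<alpha> \<alpha> "z - p" d] zp du unit \<alpha> pi by simp
    have 2: "cos (2 * \<alpha>) * norm (z - q) \<le> (z - q) \<bullet> d'"
      using inner_ge_of_axis[of v \<alpha> \<alpha> "z - q" d'] zq d'v unit \<alpha> pi by simp
    have \<gamma>: "2 * \<alpha> + (pi/4 - \<alpha>) = pi/4 + \<alpha>"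
      by simp
    have 3: "cos (pi/4 + \<alpha>) * norm (z - p) \<le> (z - p) \<bullet> e"
      using inner_ge_of_axis[of d "2 * \<alpha>" "pi/4 - \<alpha>" "z - p" e] 1 de unit \<alpha> pi
      unfolding \<gamma> by (simp add: inner_commute)
    have 4: "cos (pi/4 + \<alpha>) * norm (z - q) \<le> (z - q) \<bullet> (- e)"
      using inner_ge_of_axis[of d' "2 * \<alpha>" "pi/4 - \<alpha>" "z - q" "- e"] 2 d'e unit \<alpha> pi
      unfolding \<gamma> by (simp add: inner_commute)
    have ee: "e \<bullet> e = 1"
      using unit by (simp add: norm_eq_1)
    have q: "z - q = (z - p) - t *\<^sub>R e" and p: "z - p = (z - q) - t *\<^sub>R (- e)"
      by (simp_all add: base algebra_simps)
    have "norm (z - p) \<le> L"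
      unfolding L
    proof (rule triangle_side_le[OF \<alpha>(1) pi(1) t unit(3,4) de 1])
      have "(z - q) \<bullet> (- e) = t - (z - p) \<bullet> e"
        unfolding q by (simp add: inner_diff_left ee)
      then show "cos (pi/4 + \<alpha>) * norm ((z - p) - t *\<^sub>R e) \<le> t - (z - p) \<bullet> e"
        using 4 unfolding q[symmetric] by simp
    qed
    moreover have "norm (z - q) \<le> L"
      unfolding L
    proof (rule triangle_side_le[OF \<alpha>(1) pi(1) t _ unit(5) d'e 2])
      have "(z - p) \<bullet> e = t - (z - q) \<bullet> (- e)"
        unfolding p by (simp add: inner_diff_left inner_add_left ee)
      then show "cos (pi/4 + \<alpha>) * norm ((z - q) - t *\<^sub>R (- e)) \<le> t - (z - q) \<bullet> (- e)"
        using 3 unfolding p[symmetric] by simp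
    qed (use unit in simp)
    ultimately show ?thesis ..
  qed
  have L0: "0 \<le> L"
    using side[OF xp xq] norm_ge_zero[of "x - p"] by linarith
  have D2: "D\<^sup>2 \<le> (norm (x - y))\<^sup>2"
    using False \<open>0 \<le> D\<close> by (intro power_mono) auto
  \<comment> \<open>Stated for an arbitrary apex \<open>s\<close> and axis \<open>k\<close>, to be
    used at both cameras.\<close>
  have perp: "2 * ((norm (x - y))\<^sup>2 - ((x - y) \<bullet> k)\<^sup>2) \<le> (1 + 2 * \<alpha>) * D\<^sup>2"
    if k: "norm k = 1" and xs: "cos \<alpha> * norm (x - s) \<le> (x - s) \<bullet> k"
      and ys: "cos \<alpha> * norm (y - s) \<le> (y - s) \<bullet> k"
      and le: "norm (x - s) \<le> L" "norm (y - s) \<le> L" for s k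
  proof -
    define a b where "a = norm (x - s)" and "b = norm (y - s)"
    have w: "x - y = (x - s) - (y - s)"
      by simp
    have "cos (2 * \<alpha>) * (a * b) \<le> (x - s) \<bullet> (y - s)"
      using inner_ge_of_axis[of k \<alpha> \<alpha> "x - s" "y - s"] k xs ys \<alpha> pi by (simp add: a_def b_def)
    moreover have "(norm (x - y))\<^sup>2 = a\<^sup>2 + b\<^sup>2 - 2 * ((x - s) \<bullet> (y - s))"
      unfolding w a_def b_def power2_norm_eq_inner inner_diff_left[of "x - s" "y - s"]
        inner_diff_right[of _ "x - s" "y - s"]
      by (simp add: inner_commute)
    ultimately have "(norm (x - y))\<^sup>2 \<le> a\<^sup>2 + b\<^sup>2 - 2 * (cos (2 * \<alpha>) * (a * b))"
      by simp
    also have "\<dots> = (a - b)\<^sup>2 + 4 * (a * b) * (sin \<alpha>)\<^sup>2"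
      unfolding cos_double_sin by (simp add: power2_eq_square algebra_simps)
    finally have "a + b \<le> 2 * L * cos \<alpha>"
      using D2 \<alpha> L0 D le by (intro sum_sides_le[of \<alpha> L a b D]) (auto simp: a_def b_def)
    then have le: "((a + b) * sin \<alpha>)\<^sup>2 \<le> ((2 * L * cos \<alpha>) * sin \<alpha>)\<^sup>2"
      using \<alpha> pi by (intro power_mono mult_right_mono)
        (auto simp: a_def b_def intro!: sin_ge_zero mult_nonneg_nonneg)
    have "(norm (x - y))\<^sup>2 - ((x - y) \<bullet> k)\<^sup>2 \<le> ((a + b) * sin \<alpha>)\<^sup>2"
      unfolding w a_def b_def using \<alpha> pi by (intro norm_reject_le k xs ys) auto
    also note le
    finally have "2 * ((norm (x - y))\<^sup>2 - ((x - y) \<bullet> k)\<^sup>2) \<le> 2 * ((2 * L * cos \<alpha>) * sin \<alpha>)\<^sup>2"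
      by (rule mult_left_mono) simp
    also have "\<dots> = (1 + sin (2 * \<alpha>)) * D\<^sup>2"
      unfolding D unfolding sin_double by (simp add: power2_eq_square)
    also have "\<dots> \<le> (1 + 2 * \<alpha>) * D\<^sup>2"
      using \<alpha> sin_x_le_x[of "2 * \<alpha>"] by (intro mult_right_mono) auto
    finally show ?thesis .
  qed
  have "\<bar>d \<bullet> d'\<bar> \<le> 2 * \<alpha>"
    using abs_sin_x_le_abs_x[of "2 * \<alpha>"] \<alpha> by (simp add: dd')
  then have "\<bar>u \<bullet> v\<bar> \<le> 4 * \<alpha>"
    using abs_inner_axes_le[of u d \<alpha> v d'] unit du d'v \<alpha> by simp
  then have "(1 + \<bar>u \<bullet> v\<bar>) * (norm (x - y))\<^sup>2 \<le> (1 + 4 * \<alpha>) * (norm (x - y))\<^sup>2"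
    by (intro mult_right_mono) auto
  then have "((x - y) \<bullet> u)\<^sup>2 + ((x - y) \<bullet> v)\<^sup>2 \<le> (1 + 4 * \<alpha>) * (norm (x - y))\<^sup>2"
    using sum_inner_squares_le[OF unit(1,2), of "x - y"] by linarith
  moreover have "2 * ((norm (x - y))\<^sup>2 - ((x - y) \<bullet> u)\<^sup>2) \<le> (1 + 2 * \<alpha>) * D\<^sup>2"
    using side[OF xp xq] side[OF yp yq] by (intro perp[OF unit(1) xp yp]) auto
  moreover have "2 * ((norm (x - y))\<^sup>2 - ((x - y) \<bullet> v)\<^sup>2) \<le> (1 + 2 * \<alpha>) * D\<^sup>2"
    using side[OF xp xq] side[OF yp yq] by (intro perp[OF unit(2) xq yq]) auto
  ultimately show ?thesis
    by (simp add: algebra_simps)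
qed

section \<open>The lower bound for the whole viewing plane\<close>

lemma unc_viewplane_ge:
  assumes h: "h > 0" and \<alpha>: "0 \<le> \<alpha>" "2 * \<alpha> < pi/2" and g: "g \<in> ground"
  shows "ereal (2 * h * sin (2 * \<alpha>) / (1 - sin (2 * \<alpha>))) \<le> unc \<alpha> g (viewplane h)"
proof -
  define S C where "S = sin (2 * \<alpha>)" and "C = cos (2 * \<alpha>)"
  \<comment> \<open>\<open>H\<close> is the depth of \<open>x\<close> below the viewing plane. A
    camera at horizontal distance sqrt (h H) sees the segment from \<open>g\<close> to
    \<open>x\<close> under the largest angle, and this \<open>H\<close> makes that angle exactly 2
    \<alpha>.\<close>
  define H where "H = h * (1 + S) / (1 - S)"
  define D where "D = 2 * h * S / (1 - S)"
  define x where "x = g - vector [0, 0, D]"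
  have S0: "0 \<le> S"
    using \<alpha> by (auto simp: S_def intro!: sin_ge_zero)
  have "sin (2 * \<alpha>) < sin (pi/2)"
    using \<alpha> by (intro sin_monotone_2pi) auto
  then have S1: "S < 1"
    by (simp add: S_def)
  have C0: "C > 0"
    using \<alpha> by (auto simp: C_def intro!: cos_gt_zero_pi)
  have C2: "C\<^sup>2 = 1 - S\<^sup>2"
    by (simp add: C_def S_def cos_squared_eq)
  have H: "H = h + D" "H \<ge> h" "D \<ge> 0"
    using S0 S1 h by (simp_all add: H_def D_def field_simps)
  have \<alpha>': "\<alpha> \<le> pi" and \<alpha>'': "2 * \<alpha> < pi"
    using \<alpha> by simp_all
  have "\<exists>u. norm u = 1 \<and> g \<in> cone3 \<alpha> s u \<and> x \<in> cone3 \<alpha> s u" if s: "s \<in> viewplane h" for s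
  proof -
    define r where "r = (g $ 1 - s $ 1)\<^sup>2 + (g $ 2 - s $ 2)\<^sup>2"
    have z: "s $ 3 = h" "g $ 3 = 0"
      using s g by (simp_all add: viewplane_def ground_def)
    have r0: "r \<ge> 0"
      by (simp add: r_def)
    have ng: "(norm (g - s))\<^sup>2 = r + h\<^sup>2" and nx: "(norm (x - s))\<^sup>2 = r + H\<^sup>2"
      and gx: "(g - s) \<bullet> (x - s) = r + h * H"
      unfolding power2_norm_eq_inner
      by (simp_all add: inner_vec_def sum_3 r_def x_def z H(1) power2_eq_square algebra_simps)
    have HS: "H * (1 - S) = h * (1 + S)"
      using S1 by (simp add: H_def)
    \<comment> \<open>The factor \<open>(1 - S)\<^sup>2\<close> clears the denominator of
      \<open>H\<close>.\<close>
    have "C\<^sup>2 * (h\<^sup>2 + H\<^sup>2) * (1 - S)\<^sup>2 = (1 - S\<^sup>2) * (h\<^sup>2 * (1 - S)\<^sup>2 + (H * (1 - S))\<^sup>2)"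
      unfolding C2 by (simp add: power2_eq_square algebra_simps)
    also have "\<dots> = 2 * h * (1 + S\<^sup>2) * (h * (1 + S)) * (1 - S)"
      unfolding HS by (simp add: power2_eq_square algebra_simps)
    also have "\<dots> = 2 * h * H * (1 + S\<^sup>2) * (1 - S)\<^sup>2"
      unfolding HS[symmetric] by (simp add: power2_eq_square algebra_simps)
    finally have key: "C\<^sup>2 * (h\<^sup>2 + H\<^sup>2) = 2 * h * H * (1 + S\<^sup>2)"
      using S1 by simp
    have "(r + h * H)\<^sup>2 - C\<^sup>2 * ((r + h\<^sup>2) * (r + H\<^sup>2))
        = (1 - C\<^sup>2) * (r\<^sup>2 + (h * H)\<^sup>2) + r * (2 * h * H - C\<^sup>2 * (h\<^sup>2 + H\<^sup>2))"
      by (simp add: power2_eq_square algebra_simps)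
    \<comment> \<open>A perfect square, vanishing at the extremal camera distance
      \<open>r = h * H\<close>.\<close>
    also have "\<dots> = S\<^sup>2 * (r - h * H)\<^sup>2"
      unfolding key unfolding C2 by (simp add: power2_eq_square algebra_simps)
    finally have "C\<^sup>2 * ((r + h\<^sup>2) * (r + H\<^sup>2)) \<le> (r + h * H)\<^sup>2"
      by (metis diff_ge_0_iff_ge mult_nonneg_nonneg zero_le_power2)
    then have "(C * (norm (g - s) * norm (x - s)))\<^sup>2 \<le> ((g - s) \<bullet> (x - s))\<^sup>2"
      by (simp add: power_mult_distrib ng nx gx)
    then have "cos (2 * \<alpha>) * (norm (g - s) * norm (x - s)) \<le> (g - s) \<bullet> (x - s)"
      unfolding C_def[symmetric] by (rule power2_le_imp_le) (use gx r0 h H in simp)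
    moreover have "norm (g - s) \<noteq> 0" "norm (x - s) \<noteq> 0"
      using ng nx r0 h H by (auto simp: add_nonneg_eq_0_iff)
    ultimately obtain u where "norm u = 1" "cos \<alpha> * norm (g - s) \<le> (g - s) \<bullet> u"
      "cos \<alpha> * norm (x - s) \<le> (x - s) \<bullet> u"
      using common_axis_exists[of "g - s" "x - s" \<alpha>] \<alpha> \<alpha>'' by (metis norm_zero)
    then show ?thesis
      using cone3_iff[of u \<alpha>] \<alpha> \<alpha>' by blast
  qed
  then obtain u where u: "\<And>s. s \<in> viewplane h \<Longrightarrow>
      norm (u s) = 1 \<and> g \<in> cone3 \<alpha> s (u s) \<and> x \<in> cone3 \<alpha> s (u s)"
    by metis
  define I where "I = (\<Inter>s\<in>viewplane h. cone3 \<alpha> s (u s))"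
  \<comment> \<open>\<open>ediam\<close> is infinite on unbounded sets, so only a bounded
    \<open>I\<close> needs an estimate.\<close>
  have "ereal D \<le> ediam I"
  proof -
    have "g \<in> I" "x \<in> I"
      using u by (auto simp: I_def)
    then have "dist g x \<le> diameter I" if "bounded I"
      using diameter_bounded_bound[OF that] by blast
    moreover have "dist g x = D"
      using H(3) by (simp add: x_def dist_norm norm_eq_sqrt_inner inner_vec_def sum_3)
    ultimately show ?thesis
      by (simp add: ediam_def)
  qed
  also have "ediam I \<le> unc \<alpha> g (viewplane h)"
    unfolding unc_def I_def
    by (intro Sup_upper CollectI exI[of _ "\<lambda>s. cone3 \<alpha> s (u s)"])
      (use u in \<open>auto simp: cones_through_def\<close>)
  finally show ?thesis
    by (simp add: D_def S_def)
qed

section \<open>Comparison of the two uncertainties\<close>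

lemma ediam_le:
  assumes "0 \<le> d" "\<And>x y. x \<in> A \<Longrightarrow> y \<in> A \<Longrightarrow> norm (x - y) \<le> d"
  shows "ediam A \<le> ereal d"
proof -
  have "bounded A"
    unfolding bounded_def using assms(2) by (metis dist_norm)
  then show ?thesis
    using diameter_le[of A d] assms by (simp add: ediam_def)
qed

theorem theorem2:
  fixes h \<alpha> t :: real and g :: pt
  assumes "h > 0" and "0 \<le> \<alpha>" and "\<alpha> < 1/4"
    and "g \<in> ground"
    and "t = 2 * h / tan (pi/4 - \<alpha>)"
  shows "unc \<alpha> g {g + vector [- t/2, 0, h], g + vector [t/2, 0, h]}
           \<le> ereal (sqrt ((1 + 2*\<alpha>) / (1 - 4*\<alpha>))) * unc \<alpha> g (viewplane h)"
proof -
  define p q where "p = g + vector [- t/2, 0, h]" and "q = g + vector [t/2, 0, h]"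
  define \<gamma> S where "\<gamma> = pi/4 + \<alpha>" and "S = sin (2 * \<alpha>)"
  define D where "D = 2 * h * S / (1 - S)"
  define L where "L = t / (2 * cos (pi/4 + \<alpha>))"
  define F where "F = sqrt ((1 + 2*\<alpha>) / (1 - 4*\<alpha>))"
  define e d d' :: pt where "e = vector [1, 0, 0]" and "d = vector [sin \<gamma>, 0, - cos \<gamma>]"
    and "d' = vector [- sin \<gamma>, 0, - cos \<gamma>]"
  note h = assms(1) and \<alpha> = assms(2,3)
  have \<alpha>\<pi>: "\<alpha> < pi/4" "2 * \<alpha> < pi/2" "\<alpha> \<le> pi"
    using \<alpha> pi_gt3 by simp_all
  have cg: "cos \<gamma> > 0" and sg: "sin \<gamma> > 0"
    using \<alpha> \<alpha>\<pi> by (auto simp: \<gamma>_def intro!: cos_gt_zero_pi sin_gt_zero)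
  \<comment> \<open>\<open>pi/4 - \<alpha>\<close> and \<open>\<gamma>\<close> are complementary, so
    \<open>t\<close> is \<open>2 * h * tan \<gamma>\<close>: each camera sees \<open>g\<close> at
    angle \<open>\<gamma>\<close> from the vertical.\<close>
  have co: "sin (pi/4 - \<alpha>) = cos \<gamma>" "cos (pi/4 - \<alpha>) = sin \<gamma>"
    by (simp_all add: \<gamma>_def cos_add sin_add cos_diff sin_diff cos_45 sin_45)
  have t: "t = 2 * h * sin \<gamma> / cos \<gamma>"
    unfolding assms(5) tan_def co by simp
  have t0: "t \<ge> 0"
    using h cg sg by (simp add: t)
  have C\<gamma>: "cos (2 * \<gamma>) = - S"
    by (simp add: \<gamma>_def S_def distrib_left cos_add)
  have S: "1 - S = 2 * (cos \<gamma>)\<^sup>2" "1 + S = 2 * (sin \<gamma>)\<^sup>2"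
    using C\<gamma> cos_double_cos[of \<gamma>] cos_double_sin[of \<gamma>] by simp_all
  have D: "D = h * S / (cos \<gamma>)\<^sup>2"
    unfolding D_def S(1) by simp
  have D0: "D \<ge> 0"
    using h \<alpha> \<alpha>\<pi> unfolding D
    by (auto simp: S_def intro!: divide_nonneg_nonneg mult_nonneg_nonneg sin_ge_zero)
  have L: "L = h * sin \<gamma> / (cos \<gamma>)\<^sup>2"
    unfolding L_def \<gamma>_def[symmetric] t by (simp add: power2_eq_square)
  have DL: "(1 + S) * D\<^sup>2 = 2 * L\<^sup>2 * S\<^sup>2"
    unfolding S(2) D L by (simp add: power_mult_distrib power_divide)
  have unit: "norm e = 1" "norm d = 1" "norm d' = 1"
    by (simp_all add: e_def d_def d'_def norm_eq_1 inner_vec_def sum_3 flip: power2_eq_square)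
  have base: "q = p + t *\<^sub>R e"
    by (simp add: p_def q_def e_def vec_eq_iff forall_3)
  have de: "d \<bullet> e = cos (pi/4 - \<alpha>)" "d' \<bullet> (- e) = cos (pi/4 - \<alpha>)"
    by (simp_all add: co e_def d_def d'_def inner_vec_def sum_3)
  have dd': "d \<bullet> d' = - sin (2 * \<alpha>)"
    using C\<gamma> cos_double[of \<gamma>]
    by (simp add: d_def d'_def inner_vec_def sum_3 S_def power2_eq_square)
  \<comment> \<open>The common distance of \<open>g\<close> from both cameras.\<close>
  define l where "l = h / cos \<gamma>"
  have l: "l > 0" "g - p = l *\<^sub>R d" "g - q = l *\<^sub>R d'"
    using h cg by (simp_all add: l_def p_def q_def d_def d'_def t vec_eq_iff forall_3)
  have F0: "F \<ge> 0"
    using \<alpha> by (simp add: F_def)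
  have "unc \<alpha> g {p, q} \<le> ereal (F * D)"
    unfolding unc_def
  proof (intro Sup_least, elim CollectE exE conjE)
    fix z K
    assume K: "\<forall>s\<in>{p, q}. K s \<in> cones_through \<alpha> g s" and z: "z = ediam (\<Inter>s\<in>{p, q}. K s)"
    obtain u where u: "K p = cone3 \<alpha> p u" "norm u = 1" "g \<in> cone3 \<alpha> p u"
      using K by (auto simp: cones_through_def)
    obtain v where v: "K q = cone3 \<alpha> q v" "norm v = 1" "g \<in> cone3 \<alpha> q v"
      using K by (auto simp: cones_through_def)
    note cone = cone3_iff[OF u(2) \<alpha>(1) \<alpha>\<pi>(3)] cone3_iff[OF v(2) \<alpha>(1) \<alpha>\<pi>(3)]
    \<comment> \<open>Membership of \<open>g\<close> in the cones, divided by the distance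
      \<open>l\<close>.\<close>
    have du: "cos \<alpha> \<le> d \<bullet> u" and d'v: "cos \<alpha> \<le> d' \<bullet> v"
      using u(3) v(3) l(1) unfolding cone l(2,3) by (simp_all add: unit)
    show "z \<le> ereal (F * D)"
      unfolding z
    proof (rule ediam_le)
      fix x y
      assume "x \<in> (\<Inter>s\<in>{p, q}. K s)" "y \<in> (\<Inter>s\<in>{p, q}. K s)"
      then have "(1 - 4 * \<alpha>) * (norm (x - y))\<^sup>2 \<le> (1 + 2 * \<alpha>) * D\<^sup>2"
        using u v DL
        by (intro two_cone_dist_le[OF \<alpha> t0 D0 L_def _ u(2) v(2) unit base de dd' du d'v])
          (simp_all add: cone S_def)
      then have "(norm (x - y))\<^sup>2 \<le> (F * D)\<^sup>2"
        using \<alpha> by (simp add: F_def field_simps)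
      then show "norm (x - y) \<le> F * D"
        using F0 D0 by (rule power2_le_imp_le[OF _ mult_nonneg_nonneg])
    qed (use F0 D0 in simp)
  qed
  also have "ereal (F * D) \<le> ereal F * unc \<alpha> g (viewplane h)"
    using ereal_mult_left_mono[OF unc_viewplane_ge[OF h \<alpha>(1) \<alpha>\<pi>(2) assms(4)], of "ereal F"] F0
    by (simp add: D_def S_def)
  finally show ?thesis
    by (simp add: p_def q_def F_def)
qed

end
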